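(* Let $S$ be an infinite semigroup (written multiplicatively). For each finite coloring of $S$, there are distinct elements $a_1,a_2,\dots\in S$ and a finite subset $F$ of the (infinite) set $$\mathrm{FP}(a_1,a_2,\dots)=\{a_{i_1}a_{i_2}\cdots a_{i_m} : m\ge 1,\ i_1<i_2<\dots<i_m\}$$ such that all elements of $\mathrm{FP}(a_1,a_2,\dots)\setminus F$ have the same color.
   Context: A finite coloring of a set $A$ is an assignment of one color to each element of $A$, where the set of possible colors is finite. *)

theory Defs
  imports Main
begin

text \<open>
  A semigroup need not have a unit, so the product of a nonempty finite sequence is folded
  starting from its first factor. The increasing index sequence is \<open>i # js\<close>, whose length
  is the number \<open>m \<ge> 1\<close> of factors. Sequences are indexed from 0.
\<close>

definition FP :: "(nat \<Rightarrow> 'a::semigroup_mult) \<Rightarrow> 'a set" where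
  "FP a = {foldl (*) (a i) (map a js) | i js. sorted_wrt (<) (i # js)}"

lemma FP_base: "a i \<in> FP a"
  unfolding FP_def by (rule CollectI, rule exI[of _ i], rule exI[of _ "[]"]) simp

lemma infinite_FP:
  assumes "inj a"
  shows "infinite (FP a)"
proof
  assume "finite (FP a)"
  moreover have "range a \<subseteq> FP a"
    using FP_base by blast
  ultimately have "finite (range a)"
    by (rule rev_finite_subset)
  with assms show False
    using finite_imageD infinite_UNIV_nat by blast
qed

end

theory Submission
  imports Defs
begin

text \<open>
  Among the closed subsemigroups of the compact semigroup of ultrafilters on \<open>S\<close> that contain a
  nonprincipal ultrafilter, take a minimal one \<open>Z\<close>, and let \<open>p \<in> Z\<close> be nonprincipal. If \<open>Z p\<close>
  consists of principal ultrafilters, it is finite by compactness, so the powers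
  \<open>p\<^sup>2, p\<^sup>3, \<dots>\<close> lie in a finite subset \<open>Y\<close> of \<open>S\<close>; then one can choose distinct \<open>a\<^sub>i\<close> in any
  member of \<open>p\<close> such that all products of at least two of them lie in \<open>Y\<close>.
  Otherwise \<open>Z p = Z\<close> by minimality. If the stabilizer \<open>{z \<in> Z. z p = p}\<close> contains a nonprincipal
  ultrafilter, it equals \<open>Z\<close>, so \<open>p\<close> is idempotent and the Galvin-Glazer argument applies.
  If not, the stabilizer contains an idempotent \<open>e \<in> S\<close>, and minimality yields \<open>z \<in> Z\<close> with
  \<open>z p = p z = e\<close>. Then there are \<open>x\<^sub>0\<close> and \<open>y\<close> in \<open>S\<close> with \<open>x\<^sub>0 y = e\<close> and \<open>y x = e\<close> for
  \<open>p\<close>-almost all \<open>x\<close>, whence \<open>x = e x = x\<^sub>0 y x = x\<^sub>0 e\<close> for \<open>p\<close>-almost all \<open>x\<close>,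
  contradicting that \<open>p\<close> is nonprincipal.
\<close>

section \<open>Ultrafilters\<close>

definition ultrafilter :: "'a filter \<Rightarrow> bool" where
  "ultrafilter u \<longleftrightarrow> u \<noteq> bot \<and> (\<forall>P. eventually P u \<or> eventually (\<lambda>x. \<not> P x) u)"

lemma ultrafilter_neq_bot: "ultrafilter u \<Longrightarrow> u \<noteq> bot"
  by (simp add: ultrafilter_def)

lemma eventually_not_ultrafilter:
  assumes "ultrafilter u"
  shows "eventually (\<lambda>x. \<not> P x) u \<longleftrightarrow> \<not> eventually P u"
proof
  assume "eventually (\<lambda>x. \<not> P x) u"
  then show "\<not> eventually P u"
    using assms eventually_elim2[of "\<lambda>x. \<not> P x" u P "\<lambda>x. False"]
    by (auto simp: ultrafilter_def trivial_limit_def)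
qed (use assms in \<open>auto simp: ultrafilter_def\<close>)

lemma ultrafilter_le_imp_eq:
  assumes "ultrafilter u" "ultrafilter v" "u \<le> v"
  shows "u = v"
proof (rule antisym[OF assms(3)], rule filter_leI)
  fix P assume "eventually P u"
  then have "\<not> eventually (\<lambda>x. \<not> P x) v"
    using filter_leD[OF assms(3)] eventually_not_ultrafilter[OF assms(1)] by blast
  then show "eventually P v"
    using eventually_not_ultrafilter[OF assms(2)] by simp
qed

lemma ultrafilter_principal: "ultrafilter (principal {x})"
  by (auto simp: ultrafilter_def eventually_principal principal_eq_bot_iff)

lemma principal_singleton_eq_iff: "principal {x} = principal {y} \<longleftrightarrow> x = y"
  using principal_le_iff[of "{x}" "{y}"] by auto

text \<open>Zorn's lemma on the proper filters below \<open>F\<close>: a chain is directed, so an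
  event of its infimum already occurs in a member, which keeps the infimum proper.\<close>

lemma ex_ultrafilter_le:
  fixes F :: "'a filter"
  assumes "F \<noteq> bot"
  obtains u where "ultrafilter u" "u \<le> F"
proof -
  let ?A = "{G. G \<noteq> bot \<and> G \<le> F}"
  have "\<exists>m\<in>?A. \<forall>a\<in>?A. m \<ge> a \<longrightarrow> a = m"
  proof (rule predicate_Zorn)
    show "partial_order_on ?A (relation_of (\<ge>) ?A)"
      by (rule partial_order_on_relation_ofI) auto
  next
    fix C assume C: "C \<in> Chains (relation_of (\<ge>) ?A)"
    then have CA: "C \<subseteq> ?A"
      by (auto simp: Chains_def relation_of_def)
    show "\<exists>u\<in>?A. \<forall>a\<in>C. a \<ge> u"
    proof (cases "C = {}")
      case True
      then show ?thesis using assms by auto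
    next
      case False
      have "\<exists>x\<in>C. x \<le> inf G H" if "G \<in> C" "H \<in> C" for G H
        using C that by (auto simp: Chains_def relation_of_def)
      then have "eventually P (Inf C) \<longleftrightarrow> (\<exists>G\<in>C. eventually P G)" for P
        by (rule eventually_Inf_base[OF False])
      then have "Inf C \<noteq> bot"
        using CA by (auto simp: trivial_limit_def)
      moreover obtain G where "G \<in> C" "G \<le> F"
        using False CA by auto
      then have "Inf C \<le> F" by (rule Inf_lower2)
      ultimately have "Inf C \<in> ?A" by simp
      then show ?thesis
        by (rule bexI[rotated]) (simp add: Inf_lower)
    qed
  qed
  then obtain u where u: "u \<noteq> bot" "u \<le> F"
    and max: "\<And>G. G \<noteq> bot \<Longrightarrow> G \<le> F \<Longrightarrow> G \<le> u \<Longrightarrow> G = u"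
    by auto
  have "eventually P u \<or> eventually (\<lambda>x. \<not> P x) u" for P
  proof (rule disjCI)
    \<comment> \<open>Restricting \<open>u\<close> to \<open>P\<close> stays proper here, so
      minimality gives \<open>u\<close> back.\<close>
    assume "\<not> eventually (\<lambda>x. \<not> P x) u"
    then have "inf u (principal {x. P x}) \<noteq> bot"
      by (simp add: trivial_limit_def eventually_inf_principal)
    then have "inf u (principal {x. P x}) = u"
      using u by (intro max) (auto intro: le_infI1)
    then show "eventually P u"
      using eventually_inf_principal[of P u "{x. P x}"] by simp
  qed
  with u that show thesis by (auto simp: ultrafilter_def)
qed

text \<open>An ultrafilter that contains no singleton contains no finite set, since it contains the
  complement of each point.\<close>

lemma ultrafilter_cases:
  assumes "ultrafilter u"
  obtains "u \<le> cofinite" | x where "u = principal {x}"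
proof (cases "\<exists>x. eventually (\<lambda>y. y = x) u")
  case True
  then obtain x where "eventually (\<lambda>y. y = x) u" ..
  then have "u \<le> principal {x}"
    by (simp add: le_principal)
  then show thesis
    by (intro that(2) ultrafilter_le_imp_eq[OF assms ultrafilter_principal])
next
  case False
  have "eventually P u" if "finite {x. \<not> P x}" for P
  proof -
    have "eventually (\<lambda>x. \<forall>y\<in>{x. \<not> P x}. x \<noteq> y) u"
      using that False
      by (intro eventually_ball_finite ballI) (simp_all only: eventually_not_ultrafilter[OF assms] not_ex simp_thms)
    then show ?thesis by (rule eventually_mono) auto
  qed
  then show thesis
    using that(1) by (simp add: le_filter_def eventually_cofinite)
qed

lemma not_principal_le_cofinite: "\<not> principal {x} \<le> cofinite"
proof
  assume "principal {x} \<le> cofinite"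
  from filter_leD[OF this, of "\<lambda>y. y \<noteq> x"] show False
    by (simp add: eventually_cofinite eventually_principal)
qed

lemma eventually_finite_Union_ultrafilter:
  assumes "ultrafilter u" "finite I" "eventually (\<lambda>x. \<exists>i\<in>I. P i x) u"
  shows "\<exists>i\<in>I. eventually (P i) u"
proof (rule ccontr)
  assume "\<not> ?thesis"
  then have "eventually (\<lambda>x. \<forall>i\<in>I. \<not> P i x) u"
    using assms by (intro eventually_ball_finite) (auto simp: eventually_not_ultrafilter)
  then have "eventually (\<lambda>x. \<not> (\<exists>i\<in>I. P i x)) u"
    by (rule eventually_mono) auto
  then show False
    using assms(3) eventually_not_ultrafilter[OF assms(1), of "\<lambda>x. \<exists>i\<in>I. P i x"] by simp
qed

section \<open>The semigroup of ultrafilters\<close>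

text \<open>The product on the Stone-Cech compactification of the discrete semigroup for which
  \<open>p \<mapsto> p \<odot> q\<close> is continuous.\<close>

definition filter_mult :: "'a::semigroup_mult filter \<Rightarrow> 'a filter \<Rightarrow> 'a filter" (infixl "\<odot>" 70) where
  "p \<odot> q = Abs_filter (\<lambda>P. eventually (\<lambda>x. eventually (\<lambda>y. P (x * y)) q) p)"

lemma eventually_filter_mult:
  "eventually P (p \<odot> q) \<longleftrightarrow> eventually (\<lambda>x. eventually (\<lambda>y. P (x * y)) q) p"
  unfolding filter_mult_def
proof (rule eventually_Abs_filter, rule is_filter.intro)
  show "\<forall>\<^sub>F x in p. \<forall>\<^sub>F y in q. P (x * y) \<and> Q (x * y)"
    if "\<forall>\<^sub>F x in p. \<forall>\<^sub>F y in q. P (x * y)" "\<forall>\<^sub>F x in p. \<forall>\<^sub>F y in q. Q (x * y)" for P Q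
    using that by (simp add: eventually_conj_iff)
  show "\<forall>\<^sub>F x in p. \<forall>\<^sub>F y in q. Q (x * y)"
    if "\<forall>x. P x \<longrightarrow> Q x" "\<forall>\<^sub>F x in p. \<forall>\<^sub>F y in q. P (x * y)" for P Q
    using that(2) by (rule eventually_mono) (use that(1) in \<open>auto elim: eventually_mono\<close>)
qed simp

lemma filter_mult_assoc: "p \<odot> q \<odot> r = p \<odot> (q \<odot> r)"
  by (simp add: filter_eq_iff eventually_filter_mult mult.assoc)

lemma principal_mult_principal: "principal {x} \<odot> principal {y} = principal {x * y}"
  by (simp add: filter_eq_iff eventually_filter_mult eventually_principal)

lemma ultrafilter_mult:
  assumes "ultrafilter p" "ultrafilter q"
  shows "ultrafilter (p \<odot> q)"
  using assms unfolding ultrafilter_def[of "p \<odot> q"] trivial_limit_def eventually_filter_mult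
  by (simp add: eventually_not_ultrafilter ultrafilter_neq_bot)

section \<open>Closed sets of ultrafilters and right translations\<close>

text \<open>Closedness in the Stone topology: filters are ordered by fineness, so \<open>u \<le> Sup Z\<close> says that
  \<open>u\<close> contains every set belonging to all members of \<open>Z\<close>, i.e. that \<open>u\<close> lies in the closure
  of \<open>Z\<close>. Elements of the semigroup appear as the ultrafilters \<open>principal {x}\<close>, and an
  ultrafilter is nonprincipal iff it is finer than \<open>cofinite\<close>.\<close>

definition closed_uf :: "'a filter set \<Rightarrow> bool" where
  "closed_uf Z \<longleftrightarrow> (\<forall>u\<in>Z. ultrafilter u) \<and> (\<forall>u. ultrafilter u \<longrightarrow> u \<le> Sup Z \<longrightarrow> u \<in> Z)"

definition closed_subsemigroup :: "'a::semigroup_mult filter set \<Rightarrow> bool" where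
  "closed_subsemigroup Z \<longleftrightarrow> closed_uf Z \<and> (\<forall>p\<in>Z. \<forall>q\<in>Z. p \<odot> q \<in> Z)"

text \<open>Compactness: an infinite set \<open>X\<close> of points belongs to some nonprincipal
  ultrafilter, which would lie in the closure of \<open>Z\<close>.\<close>

lemma closed_uf_finite:
  assumes Z: "closed_uf Z" and nz: "\<And>u. u \<in> Z \<Longrightarrow> \<not> u \<le> cofinite"
  shows "finite Z"
proof -
  define X where "X = {x. principal {x} \<in> Z}"
  have ZX: "Z = (\<lambda>x. principal {x}) ` X"
  proof (intro subset_antisym subsetI)
    fix u assume u: "u \<in> Z"
    then have "ultrafilter u" using Z by (simp add: closed_uf_def)
    then show "u \<in> (\<lambda>x. principal {x}) ` X"
      using u nz by (cases rule: ultrafilter_cases) (auto simp: X_def)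
  qed (auto simp: X_def)
  have "finite X"
  proof (rule ccontr)
    assume "infinite X"
    then have "inf cofinite (principal X) \<noteq> bot"
      by (simp add: trivial_limit_def eventually_inf_principal eventually_cofinite)
    then obtain u where u: "ultrafilter u" "u \<le> inf cofinite (principal X)"
      by (rule ex_ultrafilter_le)
    have "principal X \<le> Sup Z"
      by (auto simp: ZX le_filter_def eventually_Sup eventually_principal)
    then have "u \<in> Z"
      using u Z by (auto simp: closed_uf_def intro: order_trans)
    then show False using nz u by auto
  qed
  then show ?thesis using ZX by simp
qed

text \<open>A continuous image of a compact set is closed: for \<open>u\<close> in the closure, a
  preimage is an ultrafilter \<open>w \<in> Z\<close> containing \<open>D A\<close> for all
  \<open>A\<close> in \<open>u\<close>.\<close>

lemma closed_uf_mult_right: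
  assumes Z: "closed_uf Z" and p: "ultrafilter p"
  shows "closed_uf ((\<lambda>z. z \<odot> p) ` Z)"
  unfolding closed_uf_def
proof (intro conjI ballI allI impI)
  show "ultrafilter u" if "u \<in> (\<lambda>z. z \<odot> p) ` Z" for u
    using that Z p by (auto simp: closed_uf_def intro: ultrafilter_mult)
next
  fix u assume u: "ultrafilter u" and le: "u \<le> Sup ((\<lambda>z. z \<odot> p) ` Z)"
  \<comment> \<open>\<open>A\<close> belongs to \<open>z \<odot> p\<close> iff \<open>D A\<close>
    belongs to \<open>z\<close>, so the ultrafilters below \<open>G A\<close> are the members
    \<open>z\<close> of \<open>Z\<close> with \<open>A\<close> in
    \<open>z \<odot> p\<close>.\<close>
  define D where "D A = {x. eventually (\<lambda>y. A (x * y)) p}" for A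
  define G where "G A = inf (Sup Z) (principal (D A))" for A
  have base: "eventually P (INF A\<in>{A. eventually A u}. G A) \<longleftrightarrow> (\<exists>A\<in>{A. eventually A u}. eventually P (G A))" for P
  proof (rule eventually_INF_base)
    show "{A. eventually A u} \<noteq> {}"
      using always_eventually by blast
    fix A B assume "A \<in> {A. eventually A u}" "B \<in> {A. eventually A u}"
    then have "eventually (\<lambda>x. A x \<and> B x) u" by (simp add: eventually_conj)
    moreover have "G (\<lambda>x. A x \<and> B x) \<le> inf (G A) (G B)"
      unfolding G_def by (auto simp: D_def eventually_conj_iff intro!: le_infI2)
    ultimately show "\<exists>C\<in>{A. eventually A u}. G C \<le> inf (G A) (G B)" by blast
  qed
  have "G A \<noteq> bot" if A: "eventually A u" for A
  proof
    assume "G A = bot"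
    then have "eventually (\<lambda>x. \<not> eventually (\<lambda>y. A (x * y)) p) z" if "z \<in> Z" for z
      using that by (auto simp: G_def D_def trivial_limit_def eventually_inf_principal eventually_Sup)
    then have "eventually (\<lambda>x. \<not> A x) (Sup ((\<lambda>z. z \<odot> p) ` Z))"
      by (auto simp: eventually_Sup eventually_filter_mult eventually_not_ultrafilter[OF p])
    then show False
      using filter_leD[OF le] A u eventually_not_ultrafilter by blast
  qed
  then have "(INF A\<in>{A. eventually A u}. G A) \<noteq> bot"
    using base by (auto simp: trivial_limit_def)
  then obtain w where w: "ultrafilter w" "w \<le> (INF A\<in>{A. eventually A u}. G A)"
    by (rule ex_ultrafilter_le)
  have wG: "w \<le> G A" if "eventually A u" for A
    using w(2) that by (simp add: le_INF_iff)
  have "w \<le> Sup Z"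
    using wG[of "\<lambda>x. True"] by (simp add: G_def)
  then have "w \<in> Z" using Z w by (auto simp: closed_uf_def)
  moreover have "w \<odot> p \<le> u"
  proof (rule filter_leI)
    fix A assume "eventually A u"
    then have "w \<le> principal (D A)" using wG by (simp add: G_def)
    then show "eventually A (w \<odot> p)"
      by (simp add: le_principal D_def eventually_filter_mult)
  qed
  then have "w \<odot> p = u"
    using ultrafilter_le_imp_eq ultrafilter_mult w(1) p u by blast
  ultimately show "u \<in> (\<lambda>z. z \<odot> p) ` Z" by blast
qed

lemma closed_subsemigroup_mult_right:
  assumes Z: "closed_subsemigroup Z" and p: "p \<in> Z"
  shows "closed_subsemigroup ((\<lambda>z. z \<odot> p) ` Z)"
proof -
  have "\<exists>w\<in>Z. (y \<odot> p) \<odot> (z \<odot> p) = w \<odot> p" if "y \<in> Z" "z \<in> Z" for y z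
    using that Z p by (intro bexI[of _ "y \<odot> p \<odot> z"]) (auto simp: closed_subsemigroup_def filter_mult_assoc)
  moreover have "closed_uf ((\<lambda>z. z \<odot> p) ` Z)"
    using Z p by (intro closed_uf_mult_right) (auto simp: closed_subsemigroup_def closed_uf_def)
  ultimately show ?thesis
    by (auto simp: closed_subsemigroup_def)
qed

text \<open>A fibre of the continuous map \<open>z \<mapsto> z \<odot> p\<close>. It may be empty,
  which \<open>closed_subsemigroup\<close> permits.\<close>

lemma closed_subsemigroup_stabilizer:
  assumes Z: "closed_subsemigroup Z" and p: "ultrafilter p"
  shows "closed_subsemigroup {z \<in> Z. z \<odot> p = p}"
  unfolding closed_subsemigroup_def closed_uf_def
proof (intro conjI ballI allI impI)
  show "ultrafilter u" if "u \<in> {z \<in> Z. z \<odot> p = p}" for u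
    using that Z by (auto simp: closed_subsemigroup_def closed_uf_def)
next
  fix u assume u: "ultrafilter u" and le: "u \<le> Sup {z \<in> Z. z \<odot> p = p}"
  have "Sup {z \<in> Z. z \<odot> p = p} \<le> Sup Z" by (rule Sup_subset_mono) auto
  then have "u \<in> Z"
    using u le Z by (auto simp: closed_subsemigroup_def closed_uf_def intro: order_trans)
  moreover have "u \<odot> p \<le> p"
  proof (rule filter_leI)
    fix P assume "eventually P p"
    then have "eventually P (z \<odot> p)" if "z \<in> {z \<in> Z. z \<odot> p = p}" for z
      using that by simp
    then have "eventually (\<lambda>x. eventually (\<lambda>y. P (x * y)) p) (Sup {z \<in> Z. z \<odot> p = p})"
      unfolding eventually_Sup eventually_filter_mult by blast
    then show "eventually P (u \<odot> p)"
      using filter_leD[OF le] by (simp add: eventually_filter_mult)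
  qed
  ultimately show "u \<in> {z \<in> Z. z \<odot> p = p}"
    using ultrafilter_le_imp_eq ultrafilter_mult u p by blast
next
  show "y \<odot> z \<in> {z \<in> Z. z \<odot> p = p}"
    if "y \<in> {z \<in> Z. z \<odot> p = p}" "z \<in> {z \<in> Z. z \<odot> p = p}" for y z
    using that Z by (auto simp: closed_subsemigroup_def filter_mult_assoc)
qed

section \<open>Minimal closed subsemigroups and idempotents\<close>

text \<open>By compactness, the intersection of a chain of closed sets that meet the closed set of
  ultrafilters finer than \<open>V\<close> still meets it.\<close>

lemma ex_minimal_closed_subsemigroup:
  assumes Z0: "closed_subsemigroup Z0" and u0: "u0 \<in> Z0" "u0 \<le> V"
  obtains Z u where "Z \<subseteq> Z0" "closed_subsemigroup Z" "u \<in> Z" "u \<le> V"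
    "\<And>Y v. closed_subsemigroup Y \<Longrightarrow> Y \<subseteq> Z \<Longrightarrow> v \<in> Y \<Longrightarrow> v \<le> V \<Longrightarrow> Y = Z"
proof -
  let ?A = "{Z. Z \<subseteq> Z0 \<and> closed_subsemigroup Z \<and> (\<exists>u\<in>Z. u \<le> V)}"
  have "\<exists>m\<in>?A. \<forall>a\<in>?A. m \<supseteq> a \<longrightarrow> a = m"
  proof (rule predicate_Zorn)
    show "partial_order_on ?A (relation_of (\<supseteq>) ?A)"
      by (rule partial_order_on_relation_ofI) auto
  next
    fix C assume C: "C \<in> Chains (relation_of (\<supseteq>) ?A)"
    then have CA: "C \<subseteq> ?A"
      by (auto simp: Chains_def relation_of_def)
    show "\<exists>u\<in>?A. \<forall>a\<in>C. a \<supseteq> u"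
    proof (cases "C = {}")
      case True
      then show ?thesis using Z0 u0 by auto
    next
      case False
      \<comment> \<open>For closed \<open>Z\<close>, the ultrafilters below \<open>?F Z\<close> are
        exactly the members of \<open>Z\<close> finer than \<open>V\<close>.\<close>
      let ?F = "\<lambda>Z. inf (Sup Z) V"
      have "\<exists>W\<in>C. ?F W \<le> inf (?F Y) (?F Z)" if "Y \<in> C" "Z \<in> C" for Y Z
      proof -
        have "Y \<subseteq> Z \<or> Z \<subseteq> Y"
          using C that by (auto simp: Chains_def relation_of_def)
        then show ?thesis
          using that by (auto dest: Sup_subset_mono intro: le_infI1)
      qed
      then have base: "eventually P (INF Z\<in>C. ?F Z) \<longleftrightarrow> (\<exists>Z\<in>C. eventually P (?F Z))" for P
        by (rule eventually_INF_base[OF False])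
      have "?F Z \<noteq> bot" if Z: "Z \<in> C" for Z
      proof -
        obtain u where u: "u \<in> Z" "u \<le> V" "ultrafilter u"
          using Z CA by (auto simp: closed_subsemigroup_def closed_uf_def)
        then have "u \<le> ?F Z" by (simp add: Sup_upper)
        then show ?thesis
          using ultrafilter_neq_bot[OF u(3)] by (metis bot.extremum_unique)
      qed
      then have "(INF Z\<in>C. ?F Z) \<noteq> bot"
        using base by (auto simp: trivial_limit_def)
      then obtain u where u: "ultrafilter u" "u \<le> (INF Z\<in>C. ?F Z)"
        by (rule ex_ultrafilter_le)
      then have uF: "u \<le> ?F Z" if "Z \<in> C" for Z
        using that by (simp add: le_INF_iff)
      then have "u \<in> \<Inter>C"
        using CA u(1) by (auto simp: closed_subsemigroup_def closed_uf_def)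
      moreover have "u \<le> V" using uF False by auto
      moreover have "closed_subsemigroup (\<Inter>C)"
      proof -
        have "v \<in> Z" if v: "ultrafilter v" "v \<le> Sup (\<Inter>C)" and Z: "Z \<in> C" for v Z
        proof -
          have "v \<le> Sup Z"
            using v(2) Z by (meson Inter_lower Sup_subset_mono order_trans)
          then show ?thesis using Z CA v(1) by (auto simp: closed_subsemigroup_def closed_uf_def)
        qed
        moreover have "ultrafilter v" if "v \<in> \<Inter>C" for v
          using that CA False by (auto simp: closed_subsemigroup_def closed_uf_def)
        moreover have "y \<odot> z \<in> Z" if "y \<in> \<Inter>C" "z \<in> \<Inter>C" "Z \<in> C" for y z Z
        proof -
          have "closed_subsemigroup Z" "y \<in> Z" "z \<in> Z" using that CA by auto
          then show ?thesis by (simp add: closed_subsemigroup_def)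
        qed
        ultimately show ?thesis
          unfolding closed_subsemigroup_def closed_uf_def
          by (intro conjI ballI allI impI InterI)
      qed
      moreover have "\<Inter>C \<subseteq> Z0" using False CA by auto
      ultimately show ?thesis
        by (auto intro!: bexI[of _ "\<Inter>C"])
    qed
  qed
  then obtain Z where ZA: "Z \<in> ?A" and min: "\<forall>Y\<in>?A. Y \<subseteq> Z \<longrightarrow> Y = Z" ..
  then obtain u where Z: "Z \<subseteq> Z0" "closed_subsemigroup Z" "u \<in> Z" "u \<le> V"
    by auto
  show thesis
    using Z(1) by (intro that[OF Z] min[rule_format]) auto
qed

text \<open>The Ellis-Numakura lemma: in a minimal \<open>Z\<close> any \<open>e\<close> is
  idempotent, since first \<open>Z e\<close> and then the stabilizer of \<open>e\<close> must be all
  of \<open>Z\<close>. The bound \<open>top\<close> imposes no condition.\<close>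

lemma ex_idempotent:
  assumes "closed_subsemigroup Z0" "u0 \<in> Z0"
  obtains e where "e \<in> Z0" "e \<odot> e = e"
proof -
  obtain Z e where Z: "Z \<subseteq> Z0" "closed_subsemigroup Z" "e \<in> Z"
    and min: "\<And>Y v. closed_subsemigroup Y \<Longrightarrow> Y \<subseteq> Z \<Longrightarrow> v \<in> Y \<Longrightarrow> v \<le> top \<Longrightarrow> Y = Z"
    using ex_minimal_closed_subsemigroup[OF assms, of top] by auto
  have "(\<lambda>z. z \<odot> e) ` Z = Z"
    using Z by (intro min[of _ "e \<odot> e"] closed_subsemigroup_mult_right)
      (auto simp: closed_subsemigroup_def)
  then obtain z where z: "z \<in> Z" "z \<odot> e = e"
    using Z(3) by (metis imageE)
  have "{z \<in> Z. z \<odot> e = e} = Z"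
    using Z z by (intro min[of _ z] closed_subsemigroup_stabilizer)
      (auto simp: closed_subsemigroup_def closed_uf_def)
  then show thesis using that Z by auto
qed

text \<open>A product of ultrafilters that is a point is attained by almost all pairs of factors, so
  \<open>x0\<close> and \<open>y\<close> can be chosen in the semigroup itself.\<close>

lemma two_sided_inverse_imp_principal:
  assumes p: "ultrafilter p" and z: "ultrafilter z"
    and pz: "p \<odot> z = principal {e}" and zp: "z \<odot> p = principal {e}"
    and ep: "principal {e} \<odot> p = p" and ee: "e * e = e"
  shows "\<not> p \<le> cofinite"
proof
  assume cof: "p \<le> cofinite"
  have "eventually (\<lambda>x. eventually (\<lambda>y. x * y = e) z) p"
    using pz eventually_filter_mult[of "\<lambda>x. x = e" p z] by (simp add: eventually_principal)
  then obtain x0 where x0: "eventually (\<lambda>y. x0 * y = e) z"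
    using eventually_happens' ultrafilter_neq_bot[OF p] by blast
  have "eventually (\<lambda>y. eventually (\<lambda>x. y * x = e) p) z"
    using zp eventually_filter_mult[of "\<lambda>x. x = e" z p] by (simp add: eventually_principal)
  with x0 have "eventually (\<lambda>y. x0 * y = e \<and> eventually (\<lambda>x. y * x = e) p) z"
    by (rule eventually_conj)
  then obtain y where y: "x0 * y = e" "eventually (\<lambda>x. y * x = e) p"
    using eventually_happens' ultrafilter_neq_bot[OF z] by blast
  \<comment> \<open>\<open>e\<close> fixes every product \<open>e * x\<close>, and \<open>p\<close>
    is concentrated on such products.\<close>
  have "eventually (\<lambda>x. e * x = x) (principal {e} \<odot> p)"
    by (simp add: eventually_filter_mult eventually_principal ee flip: mult.assoc)
  then have "eventually (\<lambda>x. e * x = x) p" by (simp only: ep)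
  with y(2) have "eventually (\<lambda>x. x = x0 * e) p"
    by eventually_elim (metis y(1) mult.assoc)
  then have "p = principal {x0 * e}"
    using p by (intro ultrafilter_le_imp_eq ultrafilter_principal) (auto simp: le_principal)
  then show False using cof by (simp add: not_principal_le_cofinite)
qed

text \<open>In the second alternative the powers \<open>p\<^sup>2, p\<^sup>3, \<dots>\<close> are principal and range over the
  finite set \<open>Y\<close>.\<close>

lemma ex_nonprincipal_idempotent_or_finite_powers:
  assumes "infinite (UNIV :: 'a::semigroup_mult set)"
  obtains p :: "'a::semigroup_mult filter" where "ultrafilter p" "p \<le> cofinite" "p \<odot> p = p"
  | p :: "'a::semigroup_mult filter" and Y s where "ultrafilter p" "p \<le> cofinite" "finite Y"
      "s \<in> Y" "p \<odot> p = principal {s}"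
      "\<And>y. y \<in> Y \<Longrightarrow> \<exists>t\<in>Y. principal {y} \<odot> p = principal {t}"
proof -
  have "(cofinite :: 'a::semigroup_mult filter) \<noteq> bot"
    using assms by (simp add: trivial_limit_def eventually_cofinite)
  then obtain u0 :: "'a filter" where u0: "ultrafilter u0" "u0 \<le> cofinite"
    by (rule ex_ultrafilter_le)
  have "closed_subsemigroup (Collect ultrafilter :: 'a filter set)"
    by (auto simp: closed_subsemigroup_def closed_uf_def ultrafilter_mult)
  then obtain Z and p :: "'a filter" where Z: "closed_subsemigroup Z"
    and p: "p \<in> Z" "p \<le> cofinite"
    and min: "\<And>Y v. closed_subsemigroup Y \<Longrightarrow> Y \<subseteq> Z \<Longrightarrow> v \<in> Y \<Longrightarrow> v \<le> cofinite \<Longrightarrow> Y = Z"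
    by (rule ex_minimal_closed_subsemigroup[of "Collect ultrafilter" u0 cofinite])
      (use u0 in auto)
  have uf: "ultrafilter z" if "z \<in> Z" for z
    using Z that by (simp add: closed_subsemigroup_def closed_uf_def)
  have mult: "y \<odot> z \<in> Z" if "y \<in> Z" "z \<in> Z" for y z
    using Z that by (simp add: closed_subsemigroup_def)
  \<comment> \<open>\<open>Z z\<close> is a closed subsemigroup inside \<open>Z\<close>: with a
    nonprincipal member it is \<open>Z\<close> by minimality, without one it is finite by
    compactness.\<close>
  have translate: "(\<lambda>y. y \<odot> z) ` Z = Z \<or>
      finite ((\<lambda>y. y \<odot> z) ` Z) \<and> (\<forall>v\<in>(\<lambda>y. y \<odot> z) ` Z. \<not> v \<le> cofinite)" if z: "z \<in> Z" for z
  proof (cases "\<exists>v\<in>(\<lambda>y. y \<odot> z) ` Z. v \<le> cofinite")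
    case True
    then have "(\<lambda>y. y \<odot> z) ` Z = Z"
      using min[OF closed_subsemigroup_mult_right[OF Z z]] mult z by blast
    then show ?thesis ..
  next
    case False
    then show ?thesis
      using closed_uf_finite closed_subsemigroup_mult_right[OF Z z]
      unfolding closed_subsemigroup_def by blast
  qed
  show thesis
  proof (cases "(\<lambda>y. y \<odot> p) ` Z = Z")
    case False
    let ?Zp = "(\<lambda>y. y \<odot> p) ` Z"
    define Y where "Y = {y. principal {y} \<in> ?Zp}"
    have fin: "finite ?Zp" and nc: "\<And>v. v \<in> ?Zp \<Longrightarrow> \<not> v \<le> cofinite"
      using translate[OF p(1)] False by auto
    have "finite ((\<lambda>y. principal {y}) ` Y)"
      by (rule finite_subset[OF _ fin]) (auto simp: Y_def)
    then have finY: "finite Y"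
      by (rule finite_imageD) (simp add: inj_on_def principal_singleton_eq_iff)
    have prin: "\<exists>t\<in>Y. z \<odot> p = principal {t}" if "z \<in> Z" for z
    proof -
      have "ultrafilter (z \<odot> p)" "z \<odot> p \<in> ?Zp"
        using that by (auto intro!: uf mult p)
      then show ?thesis
        by (cases rule: ultrafilter_cases) (use nc in \<open>auto simp: Y_def\<close>)
    qed
    obtain s where "s \<in> Y" "p \<odot> p = principal {s}" using prin p(1) by auto
    \<comment> \<open>The points of \<open>Y\<close> lie in \<open>Z\<close> again, so
      \<open>prin\<close> applies to them.\<close>
    moreover have "principal {y} \<in> Z" if "y \<in> Y" for y
      using that mult p(1) by (auto simp: Y_def)
    ultimately show thesis
      by (intro that(2)[of p Y s] uf p finY prin)
  next
    case Zp: True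
    let ?T = "{z \<in> Z. z \<odot> p = p}"
    have T: "closed_subsemigroup ?T"
      by (rule closed_subsemigroup_stabilizer[OF Z uf[OF p(1)]])
    show thesis
    proof (cases "\<exists>v\<in>?T. v \<le> cofinite")
      case True
      then have "?T = Z" using min[OF T] by blast
      then have "p \<odot> p = p" using p(1) by blast
      then show thesis by (intro that(1)[of p] uf p)
    next
      case False
      \<comment> \<open>Surjectivity of translation by \<open>p\<close> makes the stabilizer
        nonempty, as the existence of an idempotent requires.\<close>
      have "p \<in> (\<lambda>y. y \<odot> p) ` Z" using Zp p(1) by simp
      then obtain t where t: "p = t \<odot> p" "t \<in> Z" by (rule imageE)
      have "t \<in> ?T" using t(2) t(1)[symmetric] by simp
      then obtain e' where e': "e' \<in> ?T" "e' \<odot> e' = e'"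
        by (rule ex_idempotent[OF T])
      have "ultrafilter e'" "\<not> e' \<le> cofinite"
        using e' False uf by auto
      then obtain e where e: "e' = principal {e}"
        by (cases rule: ultrafilter_cases) auto
      have "e' \<in> (\<lambda>y. y \<odot> p) ` Z" using Zp e' by simp
      then obtain z' where z': "z' \<in> Z" "z' \<odot> p = e'" by auto
      \<comment> \<open>The factor \<open>e'\<close> makes \<open>e'\<close> a left identity of
        \<open>z\<close> and preserves \<open>z \<odot> p = e'\<close>.\<close>
      define z where "z = e' \<odot> z'"
      have z: "z \<in> Z" "z \<odot> p = e'" "e' \<odot> z = z"
        using z' e' mult filter_mult_assoc[of e' e' z'] by (auto simp: z_def filter_mult_assoc)
      have "(\<lambda>y. y \<odot> z) ` Z = Z"
      proof (rule ccontr)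
        let ?Zz = "(\<lambda>y. y \<odot> z) ` Z"
        assume neq: "?Zz \<noteq> Z"
        \<comment> \<open>\<open>Z = Z p = Z e p = Z z p p\<close> is then an image of the finite proper subset \<open>Z z\<close>.\<close>
        then have fin: "finite ?Zz" using translate[OF z(1)] by auto
        have "y \<odot> p = y \<odot> z \<odot> p \<odot> p" for y
          using z(2) e' by (simp add: filter_mult_assoc)
        then have "(\<lambda>y. y \<odot> p \<odot> p) ` ?Zz = Z"
          using Zp by (simp add: image_image)
        then have "finite Z" "card Z \<le> card ?Zz"
          using finite_imageI[OF fin] card_image_le[OF fin] by metis+
        then have "?Zz = Z"
          using mult z(1) by (intro card_seteq) auto
        then show False using neq by simp
      qed
      then have "e' \<in> (\<lambda>y. y \<odot> z) ` Z" using e' by simp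
      then obtain w where w: "w \<in> Z" "w \<odot> z = e'" by auto
      \<comment> \<open>The left inverse \<open>w\<close> of \<open>z\<close> gives
        \<open>p = e' p = w z p = w e'\<close>, hence
        \<open>p z = w e' z = w z = e'\<close>.\<close>
      have "w \<odot> e' = w \<odot> z \<odot> p" by (simp add: filter_mult_assoc z(2))
      then have "p = w \<odot> e'" using w(2) e'(1) by simp
      then have "p \<odot> z = e'"
        using z(3) w(2) by (simp add: filter_mult_assoc)
      moreover have "e * e = e"
        using e'(2) by (simp add: e principal_mult_principal principal_singleton_eq_iff)
      ultimately have "\<not> p \<le> cofinite"
        using two_sided_inverse_imp_principal[of p z e] uf p z e e' by auto
      then show thesis using p by simp
    qed
  qed
qed

section \<open>Monochromatic products\<close>

text \<open>Greedy choice: almost every \<open>y\<close> lies in \<open>B\<close> and multiplies the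
  finitely many earlier products into \<open>B\<close>; nonprincipality lets it avoid them as
  well.\<close>

lemma ex_inj_FP_subset:
  fixes p :: "'a::semigroup_mult filter"
  assumes p: "p \<noteq> bot" "p \<le> cofinite" and B: "eventually (\<lambda>x. x \<in> B) p"
    and step: "\<And>x. x \<in> B \<Longrightarrow> eventually (\<lambda>y. x * y \<in> B) p"
  obtains a :: "nat \<Rightarrow> 'a" where "inj a" "FP a \<subseteq> B"
proof -
  define good where "good R y \<longleftrightarrow> y \<in> B \<and> y \<notin> R \<and> (\<forall>x\<in>R. x * y \<in> B)" for R y
  define g where "g R = (SOME y. good R y)" for R
  \<comment> \<open>\<open>R n\<close> collects the products of terms with increasing indices below
    \<open>n\<close>; avoiding it makes \<open>a n\<close> differ from all earlier terms.\<close>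
  define R where "R = rec_nat {} (\<lambda>_ R. insert (g R) (R \<union> (\<lambda>x. x * g R) ` R))"
  define a where "a n = g (R n)" for n
  have R_Suc: "R (Suc n) = insert (a n) (R n \<union> (\<lambda>x. x * a n) ` R n)" for n
    by (simp add: R_def a_def)
  have good_g: "good R (g R)" if "finite R" "R \<subseteq> B" for R
  proof -
    have "eventually (\<lambda>y. \<forall>x\<in>R. x * y \<in> B) p"
      using that step by (intro eventually_ball_finite) auto
    moreover have "eventually (\<lambda>y. y \<notin> R) p"
      using that by (intro filter_leD[OF p(2)]) (simp add: eventually_cofinite)
    ultimately have "eventually (good R) p"
      using B unfolding good_def by (simp add: eventually_conj_iff)
    then have "\<exists>y. good R y" using p(1) eventually_happens' by blast
    then show ?thesis unfolding g_def by (rule someI_ex)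
  qed
  have R: "finite (R n) \<and> R n \<subseteq> B" for n
  proof (induction n)
    case (Suc n)
    then show ?case using good_g[of "R n"] by (auto simp: R_Suc good_def simp flip: a_def)
  qed (simp add: R_def)
  have a: "a n \<notin> R n" for n
    using good_g R by (simp add: a_def good_def)
  have mono: "R m \<subseteq> R n" if "m \<le> n" for m n
    using that by (rule lift_Suc_mono_le[rotated]) (auto simp: R_Suc)
  have "a m \<noteq> a n" if "m < n" for m n
    using a[of n] mono[of "Suc m" n] that by (auto simp: R_Suc)
  then have "inj a" by (metis injI linorder_neqE_nat)
  moreover have "foldl (*) (a i) (map a js) \<in> R (Suc (last (i # js)))"
    if "sorted_wrt (<) (i # js)" for i js
    using that
  proof (induction js rule: rev_induct)
    case Nil
    then show ?case by (simp add: R_Suc)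
  next
    case (snoc j js)
    then have IH: "foldl (*) (a i) (map a js) \<in> R (Suc (last (i # js)))"
      by (simp add: sorted_wrt_append)
    have "last (i # js) \<in> set (i # js)" by (rule last_in_set) simp
    then have "last (i # js) < j"
      using snoc.prems by (auto simp: sorted_wrt_append)
    then have "foldl (*) (a i) (map a js) \<in> R j"
      using IH mono[of "Suc (last (i # js))" j] by (auto simp: Suc_le_eq)
    then show ?case by (simp add: R_Suc)
  qed
  then have "FP a \<subseteq> B" using R by (fastforce simp: FP_def)
  ultimately show thesis by (rule that)
qed

theorem theorem2p3:
  fixes c :: "'a::semigroup_mult \<Rightarrow> 'c" and C :: "'c set"
  assumes "infinite (UNIV :: 'a set)"
    and "finite C"
    and "range c \<subseteq> C"
  shows "\<exists>(a :: nat \<Rightarrow> 'a) F. inj a \<and> finite F \<and> F \<subseteq> FP a \<and>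
           (\<forall>x \<in> FP a - F. \<forall>y \<in> FP a - F. c x = c y)"
proof -
  have colour: "\<exists>k. eventually (\<lambda>x. c x = k) p" if "ultrafilter p" for p
    using eventually_finite_Union_ultrafilter[OF that assms(2), of "\<lambda>k x. c x = k"]
      range_subsetD[OF assms(3)] by auto
  from assms(1) show ?thesis
  proof (cases rule: ex_nonprincipal_idempotent_or_finite_powers)
    case (1 p)
    obtain k where k: "eventually (\<lambda>x. c x = k) p" using colour 1 by blast
    \<comment> \<open>The Galvin-Glazer star of the colour class. Idempotence puts it in
      \<open>p\<close>, and \<open>star\<close> applied to a translate of the class shows that it is
      preserved.\<close>
    define B where "B = {x. c x = k \<and> eventually (\<lambda>y. c (x * y) = k) p}"
    have star: "eventually (\<lambda>x. P x \<and> eventually (\<lambda>y. P (x * y)) p) p" if "eventually P p" for P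
      using that eventually_filter_mult[of P p p] 1 by (simp add: eventually_conj)
    have "eventually (\<lambda>x. x \<in> B) p"
      using star[OF k] by (simp add: B_def)
    moreover have "eventually (\<lambda>y. x * y \<in> B) p" if "x \<in> B" for x
      using that star[of "\<lambda>y. c (x * y) = k"] by (simp add: B_def mult.assoc)
    ultimately obtain a where "inj a" "FP a \<subseteq> B"
      using ex_inj_FP_subset[of p B] 1 ultrafilter_neq_bot by blast
    then show ?thesis
      by (intro exI[of _ a] exI[of _ "{}"]) (auto simp: B_def)
  next
    case (2 p Y s)
    obtain k where k: "eventually (\<lambda>x. c x = k) p" using colour 2 by blast
    \<comment> \<open>\<open>Y\<close> absorbs: for almost all factors one multiplication sends an
      element of \<open>B\<close> into \<open>Y\<close>. Outside the finite set \<open>Y\<close>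
      only colour \<open>k\<close> occurs.\<close>
    define B where "B = {x. c x = k \<and> eventually (\<lambda>y. x * y \<in> Y) p} \<union> Y"
    have "eventually (\<lambda>x. x \<in> Y) (p \<odot> p)"
      using 2 by (simp add: eventually_principal)
    then have "eventually (\<lambda>x. eventually (\<lambda>y. x * y \<in> Y) p) p"
      by (simp add: eventually_filter_mult)
    with k have "eventually (\<lambda>x. x \<in> B) p"
      by eventually_elim (simp add: B_def)
    moreover have "eventually (\<lambda>y. x * y \<in> B) p" if "x \<in> B" for x
    proof -
      have "eventually (\<lambda>y. x * y \<in> Y) p" if "x \<in> Y"
      proof -
        have "eventually (\<lambda>y. y \<in> Y) (principal {x} \<odot> p)"
          using 2(6)[OF that] by (auto simp: eventually_principal)
        then show ?thesis by (simp add: eventually_filter_mult eventually_principal)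
      qed
      then have "eventually (\<lambda>y. x * y \<in> Y) p" using \<open>x \<in> B\<close> by (auto simp: B_def)
      then show ?thesis by (rule eventually_mono) (simp add: B_def)
    qed
    ultimately obtain a where "inj a" "FP a \<subseteq> B"
      using ex_inj_FP_subset[of p B] 2 ultrafilter_neq_bot by blast
    then show ?thesis
      using 2 by (intro exI[of _ a] exI[of _ "FP a \<inter> Y"]) (auto simp: B_def)
  qed
qed

end
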